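(* Let $p=p(n)\in[0,1]$ be such that $\limsup_{n\to\infty}p(n)<1/2$. Then, asymptotically almost surely (i.e., with probability tending to $1$ as $n\to\infty$), every orientation of $G\sim G(n,p)$ contains a Sullivan vertex.
   Context: $G(n,p)$ denotes the binomial random graph on $n$ vertices in which each possible edge is present independently with probability $p$. For a digraph $D$ and $v\in V(D)$: $N^+(v)=\{w\in V(D)\setminus\{v\}: vw\in E(D)\}$ is the outneighbourhood, $N^-(v)=\{w\in V(D)\setminus\{v\}: wv\in E(D)\}$ is the inneighbourhood, and $N_2^+(v)=\{w\in V(D)\setminus(\{v\}\cup N^+(v)): \text{there is an edge from some vertex of } N^+(v)\text{ to } w\}$ is the second outneighbourhood. A vertex $v$ is a Sullivan vertex if $|N_2^+(v)|\ge |N^-(v)|$. *)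

theory Defs
  imports "HOL-Probability.Probability" "Graph_Theory.Pair_Digraph"
begin

definition all_edges :: "'a set \<Rightarrow> 'a set set" where
  "all_edges V = {e. e \<subseteq> V \<and> card e = 2}"

text \<open>The binomial random graph on the vertex set \<open>{..<n}\<close>, represented by its random edge set.
  The parameter \<open>p\<close> is meant to lie in \<open>[0,1]\<close>: \<^const>\<open>bernoulli_pmf\<close> clamps other values.\<close>

definition gnp :: "nat \<Rightarrow> real \<Rightarrow> nat set set pmf" where
  "gnp n p = map_pmf (\<lambda>X. {e \<in> all_edges {..<n}. X e})
     (Pi_pmf (all_edges {..<n}) False (\<lambda>_. bernoulli_pmf p))"

text \<open>\<open>D\<close> is an orientation of the simple graph with vertex set \<open>V\<close> and edge set \<open>E\<close>;
  the disequality between truth values is exclusive or.\<close>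

definition is_orientation :: "'a set \<Rightarrow> 'a set set \<Rightarrow> 'a pair_pre_digraph \<Rightarrow> bool" where
  "is_orientation V E D \<longleftrightarrow>
     pverts D = V \<and>
     (\<forall>u v. (u, v) \<in> parcs D \<longrightarrow> {u, v} \<in> E) \<and>
     (\<forall>u v. {u, v} \<in> E \<longrightarrow> ((u, v) \<in> parcs D) \<noteq> ((v, u) \<in> parcs D))"

definition out_nbhd :: "'a pair_pre_digraph \<Rightarrow> 'a \<Rightarrow> 'a set" where
  "out_nbhd D v = {w \<in> pverts D - {v}. (v, w) \<in> parcs D}"

definition in_nbhd :: "'a pair_pre_digraph \<Rightarrow> 'a \<Rightarrow> 'a set" where
  "in_nbhd D v = {w \<in> pverts D - {v}. (w, v) \<in> parcs D}"

definition second_out_nbhd :: "'a pair_pre_digraph \<Rightarrow> 'a \<Rightarrow> 'a set" where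
  "second_out_nbhd D v =
     {w \<in> pverts D - ({v} \<union> out_nbhd D v). \<exists>u \<in> out_nbhd D v. (u, w) \<in> parcs D}"

definition sullivan_vertex :: "'a pair_pre_digraph \<Rightarrow> 'a \<Rightarrow> bool" where
  "sullivan_vertex D v \<longleftrightarrow>
     v \<in> pverts D \<and> card (second_out_nbhd D v) \<ge> card (in_nbhd D v)"

end

theory Submission
  imports Defs "HOL-Real_Asymp.Real_Asymp"
begin

text \<open>
  If \<open>p < ln n / (2 n)\<close>, a second moment computation produces an isolated vertex, which is a Sullivan
  vertex. Otherwise put \<open>x = n p\<close> and let \<open>a v\<close>, \<open>b v\<close> be the out- and indegree of \<open>v\<close> in an
  orientation without Sullivan vertex. All arcs leaving \<open>N\<^sup>+(v)\<close> end in \<open>N\<^sup>+(v) \<union> N\<^sub>2\<^sup>+(v)\<close>, and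
  \<open>|N\<^sub>2\<^sup>+(v)| < b v\<close>, so up to an error of small order pseudorandomness gives
  \<open>(\<Sum>u\<in>N\<^sup>+(v). a u) \<le> p (a v)\<^sup>2 / 2 + p (a v) (b v)\<close>. Summing over \<open>v\<close> and using
  \<open>a v + b v \<approx> x\<close> on average yields \<open>(1 - p) x\<^sup>2 n / 2 \<le> (1 - p / 2) (\<Sum>v. (a v)\<^sup>2)\<close>. On the other hand,
  a set of \<open>s\<close> vertices meets at most about \<open>p (s n - s\<^sup>2 / 2)\<close> edges, so the outdegrees are essentially
  majorized by those of a transitive orientation and \<open>(\<Sum>v. (a v)\<^sup>2) \<le> x\<^sup>2 n / 3\<close>. The two
  estimates together force \<open>p \<ge> 1 / 2\<close> up to the error.
\<close>

subsection \<open>Edges meeting a vertex set\<close>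

text \<open>One notion serves all counts: \<open>U = V\<close> gives edge and degree sums, a
  singleton \<open>S\<close> gives the edges at a vertex, and a small \<open>U\<close> gives the
  edges that can carry arcs from \<open>N\<^sup>+(v)\<close>.\<close>

definition touching :: "'a set \<Rightarrow> 'a set \<Rightarrow> 'a set set" where
  "touching U S = {e \<in> all_edges U. e \<inter> S \<noteq> {}}"

lemma finite_all_edges: "finite V \<Longrightarrow> finite (all_edges V)"
  unfolding all_edges_def by (rule finite_subset[of _ "Pow V"]) auto

lemma finite_touching: "finite U \<Longrightarrow> finite (touching U S)"
  unfolding touching_def by (simp add: finite_all_edges)

lemma all_edges_mono: "U \<subseteq> V \<Longrightarrow> all_edges U \<subseteq> all_edges V"
  unfolding all_edges_def by auto

lemma touching_subset: "U \<subseteq> V \<Longrightarrow> touching U S \<subseteq> all_edges V"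
  using all_edges_mono unfolding touching_def by blast

lemma real_choose_two: "real (n choose 2) = real n * (real n - 1) / 2"
  by (induction n) (auto simp: numeral_2_eq_2 field_simps)

lemma card_all_edges: "finite V \<Longrightarrow> real (card (all_edges V)) = real (card V) * (real (card V) - 1) / 2"
  unfolding all_edges_def by (simp add: n_subsets real_choose_two)

text \<open>The edges inside \<open>U\<close> that avoid \<open>S\<close> are exactly those of the
  complete graph on \<open>U - S\<close>, so this is a difference of two binomial
  coefficients.\<close>

lemma card_touching:
  assumes "finite U" "S \<subseteq> U"
  shows "real (card (touching U S))
    = real (card S) * real (card U) - real (card S) * (real (card S) + 1) / 2"
proof -
  have split: "all_edges U = touching U S \<union> all_edges (U - S)"
    unfolding touching_def all_edges_def by auto
  have disj: "touching U S \<inter> all_edges (U - S) = {}"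
    unfolding touching_def all_edges_def by auto
  have "card (all_edges U) = card (touching U S) + card (all_edges (U - S))"
    unfolding split by (rule card_Un_disjoint)
      (use assms disj in \<open>auto simp: finite_all_edges finite_touching\<close>)
  hence "real (card (all_edges U)) = real (card (touching U S)) + real (card (all_edges (U - S)))"
    by simp
  moreover have "real (card (U - S)) = real (card U) - real (card S)"
    using assms by (simp add: card_Diff_subset finite_subset of_nat_diff card_mono)
  ultimately show ?thesis
    using assms by (simp add: card_all_edges field_simps)
qed

text \<open>An edge has two ends, so the number of its ends in \<open>S\<close> is
  [it meets \<open>S\<close>] + 1 - [it meets \<open>V - S\<close>]. Degree sums are thereby
  controlled by the \<open>touching\<close> counts alone.\<close>

lemma sum_degrees:
  assumes fin: "finite V" and S: "S \<subseteq> V" and E: "E \<subseteq> all_edges V"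
  shows "(\<Sum>v\<in>S. real (card {e \<in> E. v \<in> e}))
    = real (card (E \<inter> touching V S)) + real (card E) - real (card (E \<inter> touching V (V - S)))"
proof -
  have finE: "finite E" and finS: "finite S"
    using E S fin finite_all_edges finite_subset by blast+
  have edge: "real (card (e \<inter> S)) = of_bool (e \<inter> S \<noteq> {}) + 1 - of_bool (e \<inter> (V - S) \<noteq> {})"
    if "e \<in> E" for e
  proof -
    have "e \<subseteq> V" "card e = 2" using that E by (auto simp: all_edges_def)
    then obtain x y where "e = {x, y}" "x \<noteq> y" "x \<in> V" "y \<in> V"
      by (auto simp: card_2_iff)
    thus ?thesis by (cases "x \<in> S"; cases "y \<in> S") auto
  qed
  have "(\<Sum>v\<in>S. real (card {e \<in> E. v \<in> e})) = (\<Sum>v\<in>S. \<Sum>e\<in>E. of_bool (v \<in> e))"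
    using finE by (simp add: Int_def)
  also have "\<dots> = (\<Sum>e\<in>E. \<Sum>v\<in>S. of_bool (v \<in> e))" by (rule sum.swap)
  also have "\<dots> = (\<Sum>e\<in>E. real (card (e \<inter> S)))"
    using finS by (simp add: Int_def conj_commute)
  also have "\<dots> = (\<Sum>e\<in>E. of_bool (e \<inter> S \<noteq> {}) + 1 - of_bool (e \<inter> (V - S) \<noteq> {}))"
    using edge by (rule sum.cong[OF refl])
  also have "\<dots> = real (card (E \<inter> {e. e \<inter> S \<noteq> {}})) + real (card E)
      - real (card (E \<inter> {e. e \<inter> (V - S) \<noteq> {}}))"
    using finE by (simp add: sum.distrib sum_subtractf)
  also have "E \<inter> {e. e \<inter> S \<noteq> {}} = E \<inter> touching V S"
    using E by (auto simp: touching_def)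
  also have "E \<inter> {e. e \<inter> (V - S) \<noteq> {}} = E \<inter> touching V (V - S)"
    using E by (auto simp: touching_def)
  finally show ?thesis .
qed

subsection \<open>Degree counts in orientations\<close>

context
  fixes V :: "'a set" and E :: "'a set set" and D :: "'a pair_pre_digraph"
  assumes fin: "finite V" and E: "E \<subseteq> all_edges V" and orient: "is_orientation V E D"
begin

lemma arc_edge:
  assumes "(u, v) \<in> parcs D"
  shows "{u, v} \<in> E" "{v, u} \<in> E" "u \<noteq> v" "u \<in> V" "v \<in> V"
proof -
  show "{u, v} \<in> E" using orient assms unfolding is_orientation_def by blast
  thus "{v, u} \<in> E" by (simp add: insert_commute)
  have "{u, v} \<subseteq> V" "card {u, v} = 2" using \<open>{u, v} \<in> E\<close> E by (auto simp: all_edges_def)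
  thus "u \<noteq> v" "u \<in> V" "v \<in> V" by auto
qed

lemma arc_antisym: "(u, v) \<in> parcs D \<Longrightarrow> (v, u) \<notin> parcs D"
  using orient arc_edge(1) unfolding is_orientation_def by blast

lemma out_nbhd_eq: "out_nbhd D v = {w. (v, w) \<in> parcs D}"
  using arc_edge(3,5) orient unfolding out_nbhd_def is_orientation_def by blast

lemma in_nbhd_eq: "in_nbhd D v = {w. (w, v) \<in> parcs D}"
  using arc_edge(3,4) orient unfolding in_nbhd_def is_orientation_def by blast

lemma nbhds_subset: "out_nbhd D v \<subseteq> V" "in_nbhd D v \<subseteq> V" "second_out_nbhd D v \<subseteq> V"
proof -
  have "pverts D = V" using orient by (simp add: is_orientation_def)
  thus "out_nbhd D v \<subseteq> V" "in_nbhd D v \<subseteq> V" "second_out_nbhd D v \<subseteq> V"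
    unfolding out_nbhd_def in_nbhd_def second_out_nbhd_def by auto
qed

lemma finite_nbhds: "finite (out_nbhd D v)" "finite (in_nbhd D v)" "finite (second_out_nbhd D v)"
  by (rule finite_subset[OF nbhds_subset(1) fin] finite_subset[OF nbhds_subset(2) fin]
    finite_subset[OF nbhds_subset(3) fin])+

lemma card_out_plus_in:
  "card (out_nbhd D v) + card (in_nbhd D v) = card {e \<in> E. v \<in> e}"
proof -
  have "out_nbhd D v \<inter> in_nbhd D v = {}"
    using arc_antisym by (auto simp: out_nbhd_eq in_nbhd_eq)
  hence "card (out_nbhd D v) + card (in_nbhd D v) = card (out_nbhd D v \<union> in_nbhd D v)"
    by (simp add: card_Un_disjoint finite_nbhds)
  also have "\<dots> = card {e \<in> E. v \<in> e}"
  proof (rule bij_betw_same_card[of "\<lambda>w. {v, w}"], rule bij_betw_imageI)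
    show "inj_on (\<lambda>w. {v, w}) (out_nbhd D v \<union> in_nbhd D v)"
      by (auto simp: inj_on_def doubleton_eq_iff)
    show "(\<lambda>w. {v, w}) ` (out_nbhd D v \<union> in_nbhd D v) = {e \<in> E. v \<in> e}"
    proof (intro equalityI subsetI)
      fix e assume "e \<in> {e \<in> E. v \<in> e}"
      hence e: "e \<in> E" "v \<in> e" by auto
      hence "card e = 2" using E by (auto simp: all_edges_def)
      then obtain w where "e = {v, w}" using e(2) by (auto simp: card_2_iff)
      moreover have "(v, w) \<in> parcs D \<or> (w, v) \<in> parcs D"
        using orient e(1) calculation unfolding is_orientation_def by blast
      ultimately show "e \<in> (\<lambda>w. {v, w}) ` (out_nbhd D v \<union> in_nbhd D v)"
        by (auto simp: out_nbhd_eq in_nbhd_eq)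
    qed (use arc_edge(1,2) in \<open>auto simp: out_nbhd_eq in_nbhd_eq\<close>)
  qed
  finally show ?thesis .
qed

text \<open>An orientation has no 2-cycles, so mapping an arc to its underlying edge is injective.
  With \<open>U = V\<close> this yields majorization of the outdegrees; with \<open>U\<close> the
  first and second outneighbourhoods it yields the local inequality.\<close>

lemma sum_out_le_touching:
  assumes "finite U" "S \<subseteq> U" "\<And>v. v \<in> S \<Longrightarrow> out_nbhd D v \<subseteq> U"
  shows "(\<Sum>v\<in>S. card (out_nbhd D v)) \<le> card (E \<inter> touching U S)"
proof -
  have "(\<Sum>v\<in>S. card (out_nbhd D v)) = card (SIGMA v:S. out_nbhd D v)"
    using finite_subset[OF assms(2,1)] finite_nbhds by (subst card_SigmaI) auto
  also have "\<dots> \<le> card (E \<inter> touching U S)"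
  proof (rule card_inj_on_le[of "\<lambda>(v, w). {v, w}"])
    show "inj_on (\<lambda>(v, w). {v, w}) (SIGMA v:S. out_nbhd D v)"
      using arc_antisym by (auto simp: inj_on_def doubleton_eq_iff out_nbhd_eq)
    show "(\<lambda>(v, w). {v, w}) ` (SIGMA v:S. out_nbhd D v) \<subseteq> E \<inter> touching U S"
    proof clarify
      fix v w assume *: "v \<in> S" "w \<in> out_nbhd D v"
      hence "(v, w) \<in> parcs D" by (simp add: out_nbhd_eq)
      with arc_edge(1,3) have "{v, w} \<in> E" "v \<noteq> w" by blast+
      moreover have "v \<in> U" "w \<in> U" using * assms by auto
      ultimately show "{v, w} \<in> E \<inter> touching U S"
        using * by (auto simp: touching_def all_edges_def)
    qed
    show "finite (E \<inter> touching U S)" using assms by (simp add: finite_touching)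
  qed
  finally show ?thesis .
qed

lemma card_edges_le_sum_out: "card E \<le> (\<Sum>v\<in>V. card (out_nbhd D v))"
proof -
  have "E \<subseteq> (\<lambda>(v, w). {v, w}) ` (SIGMA v:V. out_nbhd D v)"
  proof
    fix e assume e: "e \<in> E"
    hence "card e = 2" "e \<subseteq> V" using E by (auto simp: all_edges_def)
    then obtain v w where vw: "e = {v, w}" "v \<in> V" "w \<in> V" by (auto simp: card_2_iff)
    hence "(v, w) \<in> parcs D \<or> (w, v) \<in> parcs D"
      using orient e unfolding is_orientation_def by blast
    hence "(v, w) \<in> (SIGMA v:V. out_nbhd D v) \<or> (w, v) \<in> (SIGMA v:V. out_nbhd D v)"
      using vw by (auto simp: out_nbhd_eq)
    moreover have "e = {w, v}" using vw by auto
    ultimately show "e \<in> (\<lambda>(v, w). {v, w}) ` (SIGMA v:V. out_nbhd D v)"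
      using vw(1) by (metis (no_types, lifting) case_prod_conv image_eqI)
  qed
  hence "card E \<le> card (SIGMA v:V. out_nbhd D v)"
    using fin finite_nbhds by (intro surj_card_le) auto
  also have "\<dots> = (\<Sum>v\<in>V. card (out_nbhd D v))"
    using fin finite_nbhds by (subst card_SigmaI) auto
  finally show ?thesis .
qed

text \<open>Double counting: \<open>u\<close> lies in \<open>N\<^sup>+(v)\<close> for exactly as
  many \<open>v\<close> as \<open>u\<close> has inneighbours.\<close>

lemma sum_out_of_out_nbhds:
  fixes f :: "'a \<Rightarrow> real"
  shows "(\<Sum>v\<in>V. \<Sum>u\<in>out_nbhd D v. f u) = (\<Sum>u\<in>V. real (card (in_nbhd D u)) * f u)"
proof -
  have "(\<Sum>v\<in>V. \<Sum>u\<in>out_nbhd D v. f u) = (\<Sum>v\<in>V. \<Sum>u\<in>{u\<in>V. (v, u) \<in> parcs D}. f u)"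
    by (intro sum.cong refl) (auto simp: out_nbhd_eq dest: arc_edge)
  also have "\<dots> = (\<Sum>u\<in>V. \<Sum>v\<in>{v\<in>V. (v, u) \<in> parcs D}. f u)"
    by (rule sum.swap_restrict[OF fin fin])
  also have "\<dots> = (\<Sum>u\<in>V. \<Sum>v\<in>in_nbhd D u. f u)"
    by (intro sum.cong refl) (auto simp: in_nbhd_eq dest: arc_edge)
  finally show ?thesis by simp
qed

end

subsection \<open>Sums of squares from layers\<close>

text \<open>The midpoint rule underestimates the integral of a convex function. Here
  \<open>g\<close> is an antiderivative of \<open>(max 0 y)\<^sup>2\<close>, and
  \<open>y - 1 / 2\<close> is the midpoint of the interval from \<open>y - 1\<close> to
  \<open>y\<close>.\<close>

lemma sum_midpoint_squares_le:
  fixes x :: real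
  assumes "0 \<le> x"
  shows "(\<Sum>k<M. (max 0 (x - real k - 1 / 2))\<^sup>2) \<le> x ^ 3 / 3"
proof -
  define g where "g y = (max 0 y) ^ 3 / 3" for y :: real
  have step: "(max 0 (y - 1 / 2))\<^sup>2 \<le> g y - g (y - 1)" for y :: real
  proof -
    consider "y \<ge> 1" | "1 / 2 \<le> y" "y < 1" | "0 \<le> y" "y < 1 / 2" | "y < 0" by linarith
    thus ?thesis
    proof cases
      case 1
      thus ?thesis by (simp add: g_def field_simps power2_eq_square power3_eq_cube)
    next
      case 2
      \<comment> \<open>The claim of this case rearranges to (1 - y)^3 <= 1/4.\<close>
      have "(1 - y) ^ 3 \<le> (1 / 2) ^ 3" using 2 by (intro power_mono) auto
      thus ?thesis using 2 by (simp add: g_def field_simps power2_eq_square power3_eq_cube)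
    qed (auto simp: g_def)
  qed
  have "(\<Sum>k<M. (max 0 (x - real k - 1 / 2))\<^sup>2) \<le> (\<Sum>k<M. g (x - real k) - g (x - real (Suc k)))"
    using step[of "x - real k" for k] by (intro sum_mono) (simp add: algebra_simps)
  also have "\<dots> = g x - g (x - real M)"
    by (subst sum_lessThan_telescope') simp
  also have "\<dots> \<le> g x" by (simp add: g_def)
  finally show ?thesis using assms by (simp add: g_def)
qed

text \<open>Write the sum of squares in two ways over the layers \<open>S k\<close>. With y = p n -
  k - 1/2, layer k contributes at most 2 y s - p s^2 plus error, maximal at s = y / p when y >= 0;
  this is the layer profile of a transitive orientation. There are \<open>M\<close> layers, each
  with error 2 c.\<close>

lemma sum_squares_le_by_layers:
  fixes a :: "'a \<Rightarrow> nat" and p :: real and c :: real and n :: nat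
  assumes fin: "finite V" and p: "0 < p"
    and M: "\<And>v. v \<in> V \<Longrightarrow> a v \<le> M"
    and bound: "\<And>S. S \<subseteq> V \<Longrightarrow>
      (\<Sum>v\<in>S. real (a v)) \<le> p * (real (card S) * real n - (real (card S))\<^sup>2 / 2) + c"
  shows "(\<Sum>v\<in>V. (real (a v))\<^sup>2) \<le> (p * real n)\<^sup>2 * real n / 3 + 2 * real M * c"
proof -
  define S where "S k = {v \<in> V. k < a v}" for k
  define s where "s k = real (card (S k))" for k
  define Q where "Q = (\<Sum>v\<in>V. (real (a v))\<^sup>2)"
  have layers: "(\<Sum>v\<in>V. \<Sum>k<a v. f k v) = (\<Sum>k<M. \<Sum>v\<in>S k. f k v)" for f :: "nat \<Rightarrow> 'a \<Rightarrow> real"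
  proof -
    have "(\<Sum>v\<in>V. \<Sum>k<a v. f k v) = (\<Sum>v\<in>V. \<Sum>k\<in>{k\<in>{..<M}. k < a v}. f k v)"
    proof (intro sum.cong refl)
      fix v assume "v \<in> V"
      from M[OF this] show "{..<a v} = {k\<in>{..<M}. k < a v}" by auto
    qed
    also have "\<dots> = (\<Sum>k<M. \<Sum>v\<in>S k. f k v)"
      unfolding S_def by (rule sum.swap_restrict) (use fin in auto)
    finally show ?thesis .
  qed
  have odd: "(\<Sum>k<m. 2 * real k + 1) = (real m)\<^sup>2" for m :: nat
    by (induction m) (auto simp: power2_eq_square algebra_simps)
  have Q1: "Q = (\<Sum>k<M. (2 * real k + 1) * s k)"
    using layers[of "\<lambda>k v. 2 * real k + 1"] unfolding Q_def odd s_def by (simp add: mult.commute)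
  have "Q = (\<Sum>v\<in>V. \<Sum>k<a v. real (a v))" by (simp add: Q_def power2_eq_square)
  also have "\<dots> = (\<Sum>k<M. \<Sum>v\<in>S k. real (a v))" by (rule layers)
  also have "\<dots> \<le> (\<Sum>k<M. p * (s k * real n - (s k)\<^sup>2 / 2) + c)"
    unfolding s_def by (intro sum_mono bound) (auto simp: S_def)
  finally have Q2: "Q \<le> (\<Sum>k<M. p * (s k * real n - (s k)\<^sup>2 / 2) + c)" .
  \<comment> \<open>Bounding \<open>Q\<close> as \<open>2 Q - Q\<close> makes each layer a concave quadratic in \<open>s k\<close>.\<close>
  have "Q \<le> 2 * (\<Sum>k<M. p * (s k * real n - (s k)\<^sup>2 / 2) + c) - (\<Sum>k<M. (2 * real k + 1) * s k)"
    using Q1 Q2 by linarith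
  also have "\<dots> = (\<Sum>k<M. 2 * (p * (s k * real n - (s k)\<^sup>2 / 2) + c) - (2 * real k + 1) * s k)"
    by (simp add: sum_subtractf sum_distrib_left)
  also have "\<dots> \<le> (\<Sum>k<M. (max 0 (p * real n - real k - 1 / 2))\<^sup>2 / p + 2 * c)"
  proof (intro sum_mono)
    fix k
    define y where "y = p * real n - real k - 1 / 2"
    have "s k \<ge> 0" by (simp add: s_def)
    have "2 * y * s k - p * (s k)\<^sup>2 \<le> (max 0 y)\<^sup>2 / p"
    proof (cases "y \<ge> 0")
      case True
      have "0 \<le> (y - p * s k)\<^sup>2" by simp
      thus ?thesis using True p by (simp add: field_simps power2_eq_square)
    next
      case False
      hence "y * s k \<le> 0" using \<open>s k \<ge> 0\<close> by (simp add: mult_nonpos_nonneg)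
      moreover have "p * (s k)\<^sup>2 \<ge> 0" using p by simp
      ultimately have "2 * y * s k - p * (s k)\<^sup>2 \<le> 0" by linarith
      thus ?thesis using False by simp
    qed
    thus "2 * (p * (s k * real n - (s k)\<^sup>2 / 2) + c) - (2 * real k + 1) * s k
        \<le> (max 0 (p * real n - real k - 1 / 2))\<^sup>2 / p + 2 * c"
      unfolding y_def by (simp add: algebra_simps)
  qed
  also have "\<dots> = (\<Sum>k<M. (max 0 (p * real n - real k - 1 / 2))\<^sup>2) / p + 2 * real M * c"
    by (simp add: sum.distrib sum_divide_distrib)
  also have "\<dots> \<le> (p * real n) ^ 3 / 3 / p + 2 * real M * c"
    using sum_midpoint_squares_le[of "p * real n" M] p by (intro add_right_mono divide_right_mono) auto
  also have "(p * real n) ^ 3 / 3 / p = (p * real n)\<^sup>2 * real n / 3"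
    using p by (simp add: field_simps power2_eq_square power3_eq_cube)
  finally show ?thesis by (simp add: Q_def)
qed

subsection \<open>Pseudorandom graphs\<close>

text \<open>With x = p |V|, the global error is \<eta> x |V|, while the local error for small
  \<open>U\<close> is only \<eta> x^2: the local bound is applied once for every vertex, and the
  total must stay small against x^2 |V|.\<close>

definition pseudorandom :: "'a set \<Rightarrow> real \<Rightarrow> real \<Rightarrow> 'a set set \<Rightarrow> bool" where
  "pseudorandom V p \<eta> E \<longleftrightarrow>
     (\<forall>v\<in>V. real (card {e \<in> E. v \<in> e}) \<le> 8 * (p * real (card V))) \<and>
     (\<forall>S\<subseteq>V. \<bar>real (card (E \<inter> touching V S)) - p * real (card (touching V S))\<bar>
        \<le> \<eta> * p * (real (card V))\<^sup>2) \<and>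
     (\<forall>U\<subseteq>V. \<forall>A\<subseteq>U. real (card U) \<le> 8 * (p * real (card V)) \<longrightarrow>
        real (card (E \<inter> touching U A))
          \<le> p * real (card (touching U A)) + \<eta> * (p * real (card V))\<^sup>2)"

text \<open>The deterministic half of the argument: upper and lower bounds on degree sums, all in
  units of x^2 n, contradict each other once \<eta> is small against the gap \<gamma>.\<close>

lemma pseudorandom_imp_sullivan:
  fixes V :: "'a set"
  assumes fin: "finite V" and E: "E \<subseteq> all_edges V" and orient: "is_orientation V E D"
    and p: "0 < p" and \<gamma>: "p \<le> 1 / 2 - \<gamma>" and \<eta>: "0 < \<eta>" "200 * \<eta> \<le> \<gamma>"
    and large: "1 \<le> \<eta> * real (card V)" and pseudo: "pseudorandom V p \<eta> E"
  shows "\<exists>v. sullivan_vertex D v"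
proof (rule ccontr)
  assume none: "\<nexists>v. sullivan_vertex D v"
  define n where "n = card V"
  define x where "x = p * real n"
  define a where "a v = card (out_nbhd D v)" for v
  define b where "b v = card (in_nbhd D v)" for v
  define d where "d v = card {e \<in> E. v \<in> e}" for v
  define T where "T S = real (card (E \<inter> touching V S))" for S
  have "n > 0" using large n_def by (cases n) auto
  hence x: "x > 0" using p by (simp add: x_def)
  have d: "real (d v) = real (a v) + real (b v)" for v
    using card_out_plus_in[OF fin E orient, of v] by (simp add: a_def b_def d_def)
  have d_le: "real (d v) \<le> 8 * x" if "v \<in> V" for v
    using pseudo that unfolding pseudorandom_def d_def x_def n_def by blast
  have T: "\<bar>T S - p * (real (card S) * real n - real (card S) * (real (card S) + 1) / 2)\<bar> \<le> \<eta> * x * real n"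
    if "S \<subseteq> V" for S
  proof -
    have "\<bar>T S - p * real (card (touching V S))\<bar> \<le> \<eta> * p * (real n)\<^sup>2"
      using pseudo that unfolding pseudorandom_def T_def n_def by blast
    thus ?thesis
      unfolding card_touching[OF fin that] x_def n_def by (simp add: power2_eq_square mult.assoc)
  qed

  \<comment> \<open>Upper bound for the sum of squared outdegrees\<close>
  define Q where "Q = (\<Sum>v\<in>V. (real (a v))\<^sup>2)"
  have Q_le: "Q \<le> x\<^sup>2 * real n / 3 + 16 * \<eta> * x\<^sup>2 * real n"
  proof -
    define M where "M = nat \<lfloor>8 * x\<rfloor>"
    have M: "a v \<le> M" if "v \<in> V" for v
      using d_le[OF that] d[of v] x unfolding M_def by linarith
    have "real M \<le> 8 * x" using x by (simp add: M_def)
    have out: "(\<Sum>v\<in>S. real (a v)) \<le> p * (real (card S) * real n - (real (card S))\<^sup>2 / 2) + \<eta> * x * real n"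
      if "S \<subseteq> V" for S
    proof -
      have "(\<Sum>v\<in>S. a v) \<le> card (E \<inter> touching V S)"
        unfolding a_def using that nbhds_subset(1)[OF fin E orient]
        by (intro sum_out_le_touching[OF fin E orient fin])
      hence "(\<Sum>v\<in>S. real (a v)) \<le> T S" unfolding T_def by (metis of_nat_le_iff of_nat_sum)
      also have "\<dots> \<le> p * (real (card S) * real n - real (card S) * (real (card S) + 1) / 2) + \<eta> * x * real n"
        using T[OF that] by linarith
      also have "\<dots> \<le> p * (real (card S) * real n - (real (card S))\<^sup>2 / 2) + \<eta> * x * real n"
        using p by (intro add_right_mono mult_left_mono) (auto simp: power2_eq_square algebra_simps)
      finally show ?thesis .
    qed
    have "Q \<le> x\<^sup>2 * real n / 3 + 2 * real M * (\<eta> * x * real n)"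
      unfolding Q_def x_def
      by (rule sum_squares_le_by_layers[OF fin p M]) (use out in \<open>auto simp: x_def\<close>)
    also have "2 * real M * (\<eta> * x * real n) \<le> 2 * (8 * x) * (\<eta> * x * real n)"
      using \<open>real M \<le> 8 * x\<close> x \<eta> by (intro mult_right_mono mult_left_mono) auto
    finally show ?thesis by (simp add: power2_eq_square algebra_simps)
  qed

  \<comment> \<open>Lower bound for the sum of outdegree times degree\<close>
  define W where "W = (\<Sum>v\<in>V. real (a v) * real (d v))"
  have W_ge: "W \<ge> (1 / 2 - 34 * \<eta>) * (x\<^sup>2 * real n)"
  proof -
    \<comment> \<open>If every degree were x, then \<open>W\<close> would be x |E|, about x^2 n / 2.
      Only vertices of \<open>S\<close> lower this; their total deficit is at most 4 \<eta> x n and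
      each is weighted by \<open>a v <= 8 x\<close>, a loss of 32 \<eta> x^2 n. The estimate of |E|
      loses another 2 \<eta> x^2 n, whence the 34.\<close>
    define S where "S = {v \<in> V. real (d v) < x}"
    have S: "S \<subseteq> V" by (auto simp: S_def)
    have cards: "real (card (V - S)) = real n - real (card S)"
      using fin S by (simp add: n_def card_Diff_subset finite_subset of_nat_diff card_mono)
    have TV: "T V = real (card E)"
    proof -
      have "E \<subseteq> touching V V"
      proof
        fix e assume "e \<in> E"
        hence "e \<in> all_edges V" using E by blast
        moreover from this have "e \<subseteq> V" "e \<noteq> {}" by (auto simp: all_edges_def)
        ultimately show "e \<in> touching V V" by (auto simp: touching_def)
      qed
      thus ?thesis by (simp add: T_def Int_absorb2)
    qed
    have "(\<Sum>v\<in>S. real (d v)) = T S + T V - T (V - S)"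
      unfolding TV unfolding d_def T_def by (rule sum_degrees[OF fin S E])
    also have "\<dots> \<ge> p * (real (card S) * real n - real (card S) * (real (card S) + 1) / 2)
        + p * (real n * real n - real n * (real n + 1) / 2)
        - p * (real (card (V - S)) * real n - real (card (V - S)) * (real (card (V - S)) + 1) / 2)
        - 3 * (\<eta> * x * real n)"
      using T[OF S] T[of V] T[of "V - S"] unfolding n_def[symmetric] by fastforce
    finally have "(\<Sum>v\<in>S. real (d v)) \<ge> p * real (card S) * (real n - 1) - 3 * (\<eta> * x * real n)"
      unfolding cards by (simp add: algebra_simps add_divide_distrib diff_divide_distrib)
    hence "(\<Sum>v\<in>S. x - real (d v)) \<le> p * real (card S) + 3 * (\<eta> * x * real n)"
      by (simp add: sum_subtractf x_def algebra_simps)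
    moreover have "p * real (card S) \<le> x"
      using p fin S by (simp add: x_def n_def card_mono)
    \<comment> \<open>Hypothesis \<open>large\<close> absorbs terms of order x, here turning the
      three errors from \<open>T\<close> into four.\<close>
    moreover have "x \<le> \<eta> * x * real n" using large x by (simp add: n_def algebra_simps)
    ultimately have deficit: "(\<Sum>v\<in>S. x - real (d v)) \<le> 4 * (\<eta> * x * real n)" by linarith
    have "x * real (card E) - 8 * x * (4 * (\<eta> * x * real n)) \<le> W"
    proof -
      have "x * real (card E) \<le> x * (\<Sum>v\<in>V. real (a v))"
        using card_edges_le_sum_out[OF fin E orient] x unfolding a_def
        by (intro mult_left_mono) (metis of_nat_le_iff of_nat_sum, simp)
      moreover have "x * (\<Sum>v\<in>V. real (a v)) - W = (\<Sum>v\<in>V. real (a v) * (x - real (d v)))"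
        by (simp add: W_def sum_distrib_left sum_subtractf[symmetric] algebra_simps)
      moreover have "\<dots> \<le> (\<Sum>v\<in>V. if v \<in> S then 8 * x * (x - real (d v)) else 0)"
      proof (intro sum_mono)
        fix v assume v: "v \<in> V"
        have "real (a v) \<le> 8 * x" using d_le[OF v] d[of v] by linarith
        thus "real (a v) * (x - real (d v)) \<le> (if v \<in> S then 8 * x * (x - real (d v)) else 0)"
          using v by (auto simp: S_def intro!: mult_right_mono mult_nonneg_nonpos)
      qed
      moreover have "\<dots> = 8 * x * (\<Sum>v\<in>S. x - real (d v))"
      proof -
        have "V \<inter> S = S" using S by auto
        thus ?thesis using fin by (simp add: sum.If_cases sum_distrib_left Int_def)
      qed
      moreover have "\<dots> \<le> 8 * x * (4 * (\<eta> * x * real n))"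
        using deficit x by (intro mult_left_mono) auto
      ultimately show ?thesis by linarith
    qed
    moreover have "real (card E) \<ge> x * real n / 2 - 2 * (\<eta> * x * real n)"
    proof -
      have "real (card E) \<ge> p * (real n * real n - real n * (real n + 1) / 2) - \<eta> * x * real n"
        using T[of V] unfolding TV n_def[symmetric] by fastforce
      also have "p * (real n * real n - real n * (real n + 1) / 2) = x * real n / 2 - x / 2"
        by (simp add: x_def field_simps)
      finally show ?thesis using \<open>x \<le> \<eta> * x * real n\<close> x by linarith
    qed
    hence "x * real (card E) \<ge> x * (x * real n / 2 - 2 * (\<eta> * x * real n))"
      using x by (intro mult_left_mono) auto
    ultimately show ?thesis by (simp add: power2_eq_square algebra_simps)
  qed

  \<comment> \<open>Double counting of directed paths of length two\<close>
  define P where "P = (\<Sum>v\<in>V. real (a v) * real (b v))"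
  have W: "W = Q + P"
    unfolding W_def Q_def P_def d by (simp add: power2_eq_square algebra_simps sum.distrib)
  have P_le: "P \<le> p / 2 * Q + p * P + \<eta> * x\<^sup>2 * real n"
  proof -
    have "P = (\<Sum>v\<in>V. \<Sum>u\<in>out_nbhd D v. real (a u))"
      unfolding P_def b_def sum_out_of_out_nbhds[OF fin E orient] by (simp add: mult.commute)
    also have "\<dots> \<le> (\<Sum>v\<in>V. p / 2 * (real (a v))\<^sup>2 + p * (real (a v) * real (b v)) + \<eta> * x\<^sup>2)"
    proof (intro sum_mono)
      fix v assume v: "v \<in> V"
      define A where "A = out_nbhd D v"
      define B where "B = second_out_nbhd D v"
      note finAB = finite_nbhds(1,3)[OF fin E orient, of v, folded A_def B_def]
      have "pverts D = V" using orient by (simp add: is_orientation_def)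
      hence "card B < card (in_nbhd D v)"
        using none v unfolding sullivan_vertex_def B_def by (metis not_le)
      hence B: "real (card B) \<le> real (b v)" by (simp add: b_def)
      have disj: "A \<inter> B = {}" by (auto simp: A_def B_def second_out_nbhd_def)
      have card_AB: "real (card (A \<union> B)) = real (a v) + real (card B)"
        using finAB disj by (simp add: card_Un_disjoint a_def A_def)
      have "(\<Sum>u\<in>A. a u) \<le> card (E \<inter> touching (A \<union> B) A)"
        unfolding a_def
      proof (rule sum_out_le_touching[OF fin E orient])
        fix u assume u: "u \<in> A"
        hence vu: "(v, u) \<in> parcs D" by (simp add: A_def out_nbhd_def)
        show "out_nbhd D u \<subseteq> A \<union> B"
        proof
          fix w assume w: "w \<in> out_nbhd D u"
          hence "(u, w) \<in> parcs D" by (simp add: out_nbhd_def)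
          \<comment> \<open>\<open>B\<close> excludes \<open>v\<close> itself, so an arc from
            \<open>u\<close> back to \<open>v\<close> has to be ruled out.\<close>
          moreover have "w \<noteq> v"
            using arc_antisym[OF fin E orient vu] calculation by auto
          ultimately show "w \<in> A \<union> B"
            using u w unfolding A_def B_def second_out_nbhd_def by (auto simp: out_nbhd_def)
        qed
      qed (use finAB in auto)
      hence "(\<Sum>u\<in>A. real (a u)) \<le> real (card (E \<inter> touching (A \<union> B) A))"
        by (metis of_nat_le_iff of_nat_sum)
      also have "\<dots> \<le> p * real (card (touching (A \<union> B) A)) + \<eta> * x\<^sup>2"
      proof -
        have "A \<union> B \<subseteq> V" using nbhds_subset[OF fin E orient] by (auto simp: A_def B_def)
        \<comment> \<open>The assumption that \<open>v\<close> is not a Sullivan vertex bounds this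
          union by the degree of \<open>v\<close>, hence makes it small enough for the local
          condition.\<close>
        moreover have "real (card (A \<union> B)) \<le> 8 * x"
          using d_le[OF v] B unfolding card_AB d by linarith
        ultimately show ?thesis
          using pseudo unfolding pseudorandom_def x_def n_def by blast
      qed
      also have "real (card (touching (A \<union> B) A))
          = real (a v) * (real (a v) + real (card B)) - real (a v) * (real (a v) + 1) / 2"
        using card_touching[of "A \<union> B" A] finAB card_AB by (simp add: a_def A_def)
      also have "\<dots> \<le> (real (a v))\<^sup>2 / 2 + real (a v) * real (b v)"
      proof -
        have "real (a v) * real (card B) \<le> real (a v) * real (b v)"
          using B by (intro mult_left_mono) auto
        thus ?thesis by (simp add: power2_eq_square field_simps)
      qed
      finally show "(\<Sum>u\<in>out_nbhd D v. real (a u))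
          \<le> p / 2 * (real (a v))\<^sup>2 + p * (real (a v) * real (b v)) + \<eta> * x\<^sup>2"
        using p by (simp add: A_def algebra_simps)
    qed
    also have "\<dots> = p / 2 * Q + p * P + \<eta> * x\<^sup>2 * real n"
      by (simp add: Q_def P_def sum.distrib sum_distrib_left n_def)
    finally show ?thesis .
  qed

  \<comment> \<open>Comparison of the two bounds\<close>
  define Z where "Z = x\<^sup>2 * real n"
  have Z: "Z > 0" using x \<open>n > 0\<close> by (simp add: Z_def)
  have p_half: "p \<le> 1 / 2" using \<gamma> \<eta> by linarith
  have "(1 - p) * ((1 / 2 - 34 * \<eta>) * Z) \<le> (1 - p) * W"
    using W_ge p_half unfolding Z_def by (intro mult_left_mono) auto
  \<comment> \<open>Insert \<open>W = Q + P\<close> and use \<open>P_le\<close> in the form (1 - p)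
    P <= (p / 2) Q + \<eta> Z, which eliminates \<open>P\<close>.\<close>
  also have "\<dots> \<le> (1 - p / 2) * Q + \<eta> * Z"
    using P_le unfolding W Z_def by (simp add: algebra_simps)
  also have "(1 - p / 2) * Q \<le> (1 - p / 2) * ((1 / 3 + 16 * \<eta>) * Z)"
    using Q_le p_half unfolding Z_def by (intro mult_left_mono) (auto simp: algebra_simps)
  finally have "((1 - p) * (1 / 2 - 34 * \<eta>)) * Z \<le> ((1 - p / 2) * (1 / 3 + 16 * \<eta>) + \<eta>) * Z"
    by (simp add: algebra_simps)
  hence "(1 - p) * (1 / 2 - 34 * \<eta>) \<le> (1 - p / 2) * (1 / 3 + 16 * \<eta>) + \<eta>"
    using Z by (simp only: mult_le_cancel_right_pos)
  moreover have "p * \<eta> \<ge> 0" using p \<eta> by simp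
  \<comment> \<open>The errors add up to 34 + 16 + 1 = 51. The left side is at least \<gamma> / 3,
    hence at least 200 \<eta> / 3, which exceeds 51 \<eta>.\<close>
  ultimately have "1 / 6 - p / 3 \<le> 51 * \<eta>" by (simp add: algebra_simps diff_divide_distrib)
  thus False using \<gamma> \<eta> by linarith
qed

subsection \<open>Concentration in the binomial random graph\<close>

lemma set_pmf_gnp: "set_pmf (gnp n p) \<subseteq> Pow (all_edges {..<n})"
  by (auto simp: gnp_def)

lemma integrable_gnp [simp]: "integrable (measure_pmf (gnp n p)) (f :: _ \<Rightarrow> real)"
  by (rule integrable_measure_pmf_finite, rule finite_subset[OF set_pmf_gnp])
    (simp add: finite_all_edges)

text \<open>The generating function of a binomial variable. At z = 0, with 0^0 = 1, it gives the
  probability of avoiding \<open>F\<close>; at z = \<open>exp s\<close> it is the moment generating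
  function.\<close>

lemma expectation_gnp_power_card:
  fixes z :: real
  assumes p: "p \<in> {0..1}" and z: "0 \<le> z" and F: "F \<subseteq> all_edges {..<n}"
  shows "measure_pmf.expectation (gnp n p) (\<lambda>E. z ^ card (E \<inter> F)) = (1 - p + p * z) ^ card F"
proof -
  let ?A = "all_edges {..<n}"
  define f where "f e b = (if e \<in> F \<and> b then z else 1)" for e :: "nat set" and b :: bool
  have finA: "finite ?A" by (simp add: finite_all_edges)
  have "z ^ card ({e \<in> ?A. X e} \<inter> F) = (\<Prod>e\<in>?A. f e (X e))" for X
  proof -
    have "{e \<in> ?A. X e} \<inter> F = ?A \<inter> {e. e \<in> F \<and> X e}" by auto
    thus ?thesis using finA by (simp add: f_def prod.If_cases)
  qed
  hence "measure_pmf.expectation (gnp n p) (\<lambda>E. z ^ card (E \<inter> F))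
      = measure_pmf.expectation (Pi_pmf ?A False (\<lambda>_. bernoulli_pmf p)) (\<lambda>X. \<Prod>e\<in>?A. f e (X e))"
    by (simp add: gnp_def)
  also have "\<dots> = (\<Prod>e\<in>?A. measure_pmf.expectation (bernoulli_pmf p) (f e))"
    by (rule expectation_prod_Pi_pmf)
      (use z in \<open>auto simp: finA f_def intro: integrable_measure_pmf_finite\<close>)
  also have "\<dots> = (\<Prod>e\<in>?A. if e \<in> F then 1 - p + p * z else 1)"
    using p by (intro prod.cong refl) (auto simp: f_def)
  also have "\<dots> = (1 - p + p * z) ^ card F"
    using F finA by (simp add: prod.If_cases Int_absorb1)
  finally show ?thesis .
qed

lemma expectation_gnp_avoid:
  assumes p: "p \<in> {0..1}" and F: "F \<subseteq> all_edges {..<n}"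
  shows "measure_pmf.expectation (gnp n p) (\<lambda>E. of_bool (E \<inter> F = {})) = (1 - p) ^ card F"
proof -
  have "finite F" using F finite_all_edges finite_subset by blast
  hence "of_bool (E \<inter> F = {}) = (0::real) ^ card (E \<inter> F)" for E
    by (simp add: power_0_left)
  thus ?thesis using expectation_gnp_power_card[OF p order_refl F] by simp
qed

text \<open>Exponential Markov inequality together with 1 + y <= exp y. Keeping \<open>s\<close>
  inside the event treats both tails at once: a negative \<open>s\<close> gives the lower
  tail.\<close>

lemma gnp_chernoff:
  assumes p: "p \<in> {0..1}" and F: "F \<subseteq> all_edges {..<n}"
  shows "measure_pmf.prob (gnp n p) {E. w \<le> s * (real (card (E \<inter> F)) - p * real (card F))}
    \<le> exp (p * real (card F) * (exp s - 1 - s) - w)"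
proof -
  define c where "c = exp (w + s * p * real (card F))"
  have "{E. w \<le> s * (real (card (E \<inter> F)) - p * real (card F))} = {E. c \<le> exp s ^ card (E \<inter> F)}"
    unfolding c_def exp_of_nat_mult[symmetric] by (auto simp: algebra_simps)
  hence "measure_pmf.prob (gnp n p) {E. w \<le> s * (real (card (E \<inter> F)) - p * real (card F))}
      \<le> measure_pmf.expectation (gnp n p) (\<lambda>E. exp s ^ card (E \<inter> F)) / c"
    using integral_Markov_inequality_measure[of "gnp n p" "\<lambda>E. exp s ^ card (E \<inter> F)" "{}" c]
    by (simp add: c_def)
  also have "\<dots> = (1 - p + p * exp s) ^ card F / c"
    by (subst expectation_gnp_power_card[OF p _ F]) auto
  also have "\<dots> \<le> exp (p * (exp s - 1)) ^ card F / c"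
  proof (intro divide_right_mono power_mono)
    show "1 - p + p * exp s \<le> exp (p * (exp s - 1))"
      using exp_ge_add_one_self[of "p * (exp s - 1)"] by (simp add: algebra_simps)
  qed (use p in \<open>auto simp: c_def\<close>)
  also have "\<dots> = exp (p * real (card F) * (exp s - 1 - s) - w)"
    unfolding c_def exp_of_nat_mult[symmetric] exp_diff[symmetric] by (simp add: algebra_simps)
  finally show ?thesis .
qed

lemma exp_minus_linear_le_square:
  fixes s :: real
  assumes "\<bar>s\<bar> \<le> 1"
  shows "exp s - 1 - s \<le> s\<^sup>2"
proof (cases "s \<ge> 0")
  case True
  thus ?thesis using exp_bound[of s] assms by linarith
next
  case False
  \<comment> \<open>The product is 1 - s^3, which is at least 1 for negative s.\<close>
  have "1 \<le> (1 + s + s\<^sup>2) * (1 - s)"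
    using False mult_nonneg_nonneg[of "- s" "s * s"]
    by (simp add: algebra_simps power2_eq_square)
  also have "\<dots> \<le> (1 + s + s\<^sup>2) * exp (- s)"
  proof (rule mult_left_mono)
    show "0 \<le> 1 + s + s\<^sup>2" using assms by (simp add: add_nonneg_nonneg)
  qed (use exp_ge_add_one_self[of "- s"] in simp)
  finally show ?thesis by (simp add: exp_minus field_simps)
qed

text \<open>Second moment method for the number \<open>X\<close> of isolated vertices. Two vertices
  share one potential edge, so they meet 2 n - 3 edges instead of 2 (n - 1); this correlation
  accounts for 1 / (1 - p) - 1.\<close>

lemma prob_gnp_no_isolated_le:
  assumes p: "0 \<le> p" "p < 1" and n: "2 \<le> n"
  shows "measure_pmf.prob (gnp n p) {E. \<forall>v<n. E \<inter> touching {..<n} {v} \<noteq> {}}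
    \<le> 1 / (real n * (1 - p) ^ (n - 1)) + 1 / (1 - p) - 1"
proof -
  let ?V = "{..<n}"
  define q where "q = 1 - p"
  have q: "0 < q" "q \<le> 1" using p by (auto simp: q_def)
  have p': "p \<in> {0..1}" using p by auto
  define I where "I v E = (of_bool (E \<inter> touching ?V {v} = {}) :: real)" for v E
  define X where "X E = (\<Sum>v<n. I v E)" for E
  define \<mu> where "\<mu> = real n * q ^ (n - 1)"
  have \<mu>: "\<mu> > 0" using n q by (simp add: \<mu>_def)
  have card1: "card (touching ?V {v}) = n - 1" if "v < n" for v
  proof -
    have "real (card (touching ?V {v})) = real n - 1"
      using card_touching[of ?V "{v}"] that by simp
    thus ?thesis using n by linarith
  qed
  have card2: "card (touching ?V {u, v}) = 2 * n - 3" if "u < n" "v < n" "u \<noteq> v" for u v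
  proof -
    have "real (card (touching ?V {u, v})) = 2 * real n - 3"
      using card_touching[of ?V "{u, v}"] that by simp
    thus ?thesis using n by linarith
  qed
  have EI: "measure_pmf.expectation (gnp n p) (I v) = q ^ (n - 1)" if "v < n" for v
    unfolding I_def using expectation_gnp_avoid[OF p' touching_subset[OF order_refl]] card1[OF that]
    by (simp add: q_def)
  have EII: "measure_pmf.expectation (gnp n p) (\<lambda>E. I u E * I v E)
      = (if u = v then q ^ (n - 1) else q ^ (2 * n - 3))" if "u < n" "v < n" for u v
  proof -
    have "touching ?V {u} \<union> touching ?V {v} = touching ?V {u, v}"
      by (auto simp: touching_def)
    hence "I u E * I v E = of_bool (E \<inter> touching ?V {u, v} = {})" for E
      unfolding I_def of_bool_conj[symmetric] by (intro arg_cong[of _ _ of_bool]) blast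
    hence "measure_pmf.expectation (gnp n p) (\<lambda>E. I u E * I v E) = q ^ card (touching ?V {u, v})"
      using expectation_gnp_avoid[OF p' touching_subset[OF order_refl]] by (simp add: q_def)
    thus ?thesis using that card1[of u] card2[of u v] by auto
  qed
  have EX: "measure_pmf.expectation (gnp n p) X = \<mu>"
    unfolding X_def by (simp add: EI \<mu>_def)
  have "measure_pmf.expectation (gnp n p) (\<lambda>E. (X E)\<^sup>2)
      = (\<Sum>u<n. \<Sum>v<n. measure_pmf.expectation (gnp n p) (\<lambda>E. I u E * I v E))"
    unfolding X_def power2_eq_square sum_product by simp
  also have "\<dots> = (\<Sum>u<n. \<Sum>v<n. if u = v then q ^ (n - 1) else q ^ (2 * n - 3))"
    by (simp add: EII)
  also have "\<dots> \<le> (\<Sum>u<n. \<Sum>v<n. (if u = v then q ^ (n - 1) else 0) + q ^ (2 * n - 3))"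
    using q by (intro sum_mono) auto
  also have "\<dots> = \<mu> + (real n)\<^sup>2 * q ^ (2 * n - 3)"
    by (simp add: sum.distrib \<mu>_def power2_eq_square algebra_simps)
  also have "(real n)\<^sup>2 * q ^ (2 * n - 3) = \<mu>\<^sup>2 / q"
  proof -
    have "q ^ (n - 1) * q ^ (n - 1) = q ^ (2 * n - 3) * q"
      using n unfolding power_add[symmetric] power_Suc2[symmetric]
      by (intro arg_cong[of _ _ "\<lambda>k. q ^ k"]) linarith
    thus ?thesis using q by (simp add: \<mu>_def power2_eq_square field_simps)
  qed
  finally have EX2: "measure_pmf.expectation (gnp n p) (\<lambda>E. (X E)\<^sup>2) \<le> \<mu> + \<mu>\<^sup>2 / q" .
  let ?B = "{E. \<forall>v<n. E \<inter> touching ?V {v} \<noteq> {}}"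
  \<comment> \<open>Chebyshev's inequality written out: on \<open>?B\<close> the count
    \<open>X\<close> vanishes, so its squared deviation from the mean is
    \<open>\<mu>\<^sup>2\<close>.\<close>
  have "\<mu>\<^sup>2 * measure_pmf.prob (gnp n p) ?B
      = measure_pmf.expectation (gnp n p) (\<lambda>E. \<mu>\<^sup>2 * indicator ?B E)" by simp
  also have "\<dots> \<le> measure_pmf.expectation (gnp n p) (\<lambda>E. (X E)\<^sup>2 - 2 * \<mu> * X E + \<mu>\<^sup>2)"
  proof (intro integral_mono)
    fix E
    have "X E = 0" if "E \<in> ?B" using that by (simp add: X_def I_def)
    moreover have "0 \<le> (X E - \<mu>)\<^sup>2" by simp
    ultimately show "\<mu>\<^sup>2 * indicator ?B E \<le> (X E)\<^sup>2 - 2 * \<mu> * X E + \<mu>\<^sup>2"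
      by (cases "E \<in> ?B") (auto simp: power2_diff algebra_simps)
  qed auto
  also have "\<dots> = measure_pmf.expectation (gnp n p) (\<lambda>E. (X E)\<^sup>2) - 2 * \<mu> * \<mu> + \<mu>\<^sup>2"
    by (simp add: EX)
  also have "\<dots> \<le> \<mu> + \<mu>\<^sup>2 / q - \<mu>\<^sup>2" using EX2 by (simp add: power2_eq_square)
  finally have "measure_pmf.prob (gnp n p) ?B \<le> (\<mu> + \<mu>\<^sup>2 / q - \<mu>\<^sup>2) / \<mu>\<^sup>2"
    using \<mu> by (simp add: field_simps)
  also have "\<dots> = 1 / \<mu> + 1 / q - 1"
    using \<mu> q by (simp add: field_simps power2_eq_square)
  finally show ?thesis by (simp add: \<mu>_def q_def)
qed

lemma sum_Pow_power_card:
  fixes z :: real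
  assumes "finite V"
  shows "(\<Sum>U\<in>Pow V. z ^ card U) = (1 + z) ^ card V"
  using prod_add[OF assms, of "\<lambda>_. z" "\<lambda>_. 1"] by (simp add: add.commute)

text \<open>Union bound over the three clauses, with Chernoff parameters 1, \<eta> or -\<eta>, and
  \<open>s\<close>. By \<open>rate\<close> a fixed pair \<open>(U, A)\<close> fails with probability
  at most exp(-9 x ln n), where x = n p: a factor exp(-8 x ln n) pays for the choice of
  \<open>U\<close>, and exp(-x ln n) is left over.\<close>

lemma prob_gnp_not_pseudorandom_le:
  assumes p: "p \<in> {0..1}" and n: "2 \<le> n" and pn: "ln (real n) / 2 \<le> p * real n"
    and \<eta>: "0 < \<eta>" "\<eta> \<le> 1" and s: "0 \<le> s"
    and rate: "9 * ln (real n) \<le> p * real n * (s * \<eta> - 32 * p * (exp s - 1 - s))"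
  shows "measure_pmf.prob (gnp n p) {E. E \<subseteq> all_edges {..<n} \<and> \<not> pseudorandom {..<n} p \<eta> E}
    \<le> real n * exp (- 3 * ln (real n)) + 2 * 2 ^ n * exp (- (\<eta>\<^sup>2 * real n * ln (real n) / 4))
      + exp 2 * exp (- ((ln (real n))\<^sup>2 / 2))"
proof -
  let ?V = "{..<n}" and ?P = "measure_pmf.prob (gnp n p)"
  define x where "x = p * real n"
  define L where "L = ln (real n)"
  have L: "0 < L" using n by (simp add: L_def)
  have x: "L / 2 \<le> x" "0 \<le> x" using pn L by (auto simp: x_def L_def)
  have card_touching_le: "real (card (touching U S)) \<le> (real (card U))\<^sup>2 / 2" if "finite U" "S \<subseteq> U"
    for U S :: "nat set"
  proof -
    have "0 \<le> (real (card U) - real (card S))\<^sup>2" by simp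
    thus ?thesis unfolding card_touching[OF that] by (simp add: power2_eq_square field_simps)
  qed
  \<comment> \<open>A degree has mean at most x, so exceeding 8 x means a deviation of at least 7 x.
    The factors 1, \<open>\<sigma> * \<eta>\<close> and \<open>s\<close> in the three events are the
    Chernoff parameters.\<close>
  define B1 where "B1 v = {E. 7 * x \<le> 1 * (real (card (E \<inter> touching ?V {v})) - p * real (card (touching ?V {v})))}"
    for v
  define B2 where "B2 \<sigma> S = {E. \<eta> * (\<eta> * x * real n)
      \<le> (\<sigma> * \<eta>) * (real (card (E \<inter> touching ?V S)) - p * real (card (touching ?V S)))}" for \<sigma> :: real and S
  define B3 where "B3 U A = {E. s * (\<eta> * x\<^sup>2)
      \<le> s * (real (card (E \<inter> touching U A)) - p * real (card (touching U A)))}" for U A :: "nat set"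
  define \<U> where "\<U> = {U. U \<subseteq> ?V \<and> real (card U) \<le> 8 * x}"
  have fin\<U>: "finite \<U>" "\<U> \<subseteq> Pow ?V" unfolding \<U>_def by auto
  have fin_sub: "finite U" if "U \<in> \<U>" for U using that finite_subset by (auto simp: \<U>_def)

  have cover: "{E. E \<subseteq> all_edges ?V \<and> \<not> pseudorandom ?V p \<eta> E}
      \<subseteq> (\<Union>v<n. B1 v) \<union> (\<Union>\<sigma>\<in>{1, -1}. \<Union>S\<in>Pow ?V. B2 \<sigma> S) \<union> (\<Union>U\<in>\<U>. \<Union>A\<in>Pow U. B3 U A)"
  proof
    fix E assume "E \<in> {E. E \<subseteq> all_edges ?V \<and> \<not> pseudorandom ?V p \<eta> E}"
    hence E: "E \<subseteq> all_edges ?V" and "\<not> pseudorandom ?V p \<eta> E" by auto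
    then consider v where "v < n" "8 * x < real (card {e \<in> E. v \<in> e})"
      | S where "S \<subseteq> ?V" "\<eta> * x * real n < \<bar>real (card (E \<inter> touching ?V S)) - p * real (card (touching ?V S))\<bar>"
      | U A where "U \<in> \<U>" "A \<subseteq> U" "p * real (card (touching U A)) + \<eta> * x\<^sup>2 < real (card (E \<inter> touching U A))"
      unfolding pseudorandom_def x_def \<U>_def by (auto simp: not_le power2_eq_square mult.assoc)
    thus "E \<in> (\<Union>v<n. B1 v) \<union> (\<Union>\<sigma>\<in>{1, -1}. \<Union>S\<in>Pow ?V. B2 \<sigma> S) \<union> (\<Union>U\<in>\<U>. \<Union>A\<in>Pow U. B3 U A)"
    proof cases
      case 1
      have "{e \<in> E. v \<in> e} = E \<inter> touching ?V {v}" using E by (auto simp: touching_def)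
      moreover have "real (card (touching ?V {v})) \<le> real n"
        using card_touching[of ?V "{v}"] 1 by simp
      hence "p * real (card (touching ?V {v})) \<le> x"
        using p by (auto simp: x_def intro: mult_left_mono)
      ultimately have "E \<in> B1 v" using 1 by (simp add: B1_def)
      thus ?thesis using 1 by blast
    next
      case 2
      define y where "y = real (card (E \<inter> touching ?V S)) - p * real (card (touching ?V S))"
      have "\<eta> * x * real n \<le> y \<or> \<eta> * x * real n \<le> - y"
        using 2 unfolding y_def by linarith
      hence "\<eta> * (\<eta> * x * real n) \<le> \<eta> * y \<or> \<eta> * (\<eta> * x * real n) \<le> \<eta> * (- y)"
        using \<eta> by (meson less_imp_le mult_left_mono)
      hence "E \<in> B2 1 S \<or> E \<in> B2 (-1) S" by (simp add: B2_def flip: y_def)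
      thus ?thesis using 2 by blast
    next
      case 3
      hence "E \<in> B3 U A" using s by (auto simp: B3_def intro!: mult_left_mono)
      thus ?thesis using 3 by blast
    qed
  qed

  have P1: "?P (\<Union>v<n. B1 v) \<le> real n * exp (- 3 * L)"
  proof -
    have "?P (\<Union>v<n. B1 v) \<le> (\<Sum>v<n. ?P (B1 v))"
      by (rule measure_pmf.finite_measure_subadditive_finite) auto
    also have "\<dots> \<le> (\<Sum>v<n. exp (- 3 * L))"
    proof (rule sum_mono)
      fix v assume "v \<in> {..<n}"
      hence "real (card (touching ?V {v})) \<le> real n"
        using card_touching[of ?V "{v}"] by simp
      \<comment> \<open>Since e - 2 <= 1, the exponent is at most x - 7 x = -6 x, and x >= L /
        2.\<close>
      hence "p * real (card (touching ?V {v})) * (exp 1 - 1 - 1) \<le> x * 1"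
        using p exp_le exp_ge_add_one_self[of 1] unfolding x_def by (intro mult_mono mult_left_mono) auto
      hence "exp (p * real (card (touching ?V {v})) * (exp 1 - 1 - 1) - 7 * x) \<le> exp (- 3 * L)"
        using x by simp
      thus "?P (B1 v) \<le> exp (- 3 * L)"
        unfolding B1_def using gnp_chernoff[OF p touching_subset[OF order_refl]] order_trans by blast
    qed
    finally show ?thesis by simp
  qed

  have P2: "?P (\<Union>S\<in>Pow ?V. B2 \<sigma> S) \<le> 2 ^ n * exp (- (\<eta>\<^sup>2 * real n * L / 4))"
    if \<sigma>: "\<bar>\<sigma>\<bar> = 1" for \<sigma> :: real
  proof -
    have "?P (\<Union>S\<in>Pow ?V. B2 \<sigma> S) \<le> (\<Sum>S\<in>Pow ?V. ?P (B2 \<sigma> S))"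
      by (rule measure_pmf.finite_measure_subadditive_finite) auto
    also have "\<dots> \<le> (\<Sum>S\<in>Pow ?V. exp (- (\<eta>\<^sup>2 * real n * L / 4)))"
    proof (rule sum_mono)
      fix S assume S: "S \<in> Pow ?V"
      have "\<bar>\<sigma> * \<eta>\<bar> \<le> 1" using \<sigma> \<eta> by (simp add: abs_mult)
      hence "exp (\<sigma> * \<eta>) - 1 - \<sigma> * \<eta> \<le> (\<sigma> * \<eta>)\<^sup>2" by (rule exp_minus_linear_le_square)
      moreover have "(\<sigma> * \<eta>)\<^sup>2 = \<eta>\<^sup>2" using \<sigma> by (simp add: power_mult_distrib power2_eq_1_iff abs_if split: if_splits)
      moreover have "0 \<le> exp (\<sigma> * \<eta>) - 1 - \<sigma> * \<eta>"
        using exp_ge_add_one_self[of "\<sigma> * \<eta>"] by linarith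
      \<comment> \<open>This cost is half of the gain \<eta>^2 x n. The remaining exponent has order
        n ln n and so beats the 2^n choices of \<open>S\<close>.\<close>
      ultimately have "p * real (card (touching ?V S)) * (exp (\<sigma> * \<eta>) - 1 - \<sigma> * \<eta>)
          \<le> p * ((real n)\<^sup>2 / 2) * \<eta>\<^sup>2"
        using p card_touching_le[of ?V S] S
        by (intro mult_mono mult_left_mono) auto
      moreover have "p * ((real n)\<^sup>2 / 2) * \<eta>\<^sup>2 - \<eta> * (\<eta> * x * real n) = - (\<eta>\<^sup>2 * real n * x / 2)"
        by (simp add: x_def power2_eq_square)
      moreover have "\<eta>\<^sup>2 * real n * x / 2 \<ge> \<eta>\<^sup>2 * real n * L / 4"
      proof -
        have "\<eta>\<^sup>2 * real n * (L / 2) \<le> \<eta>\<^sup>2 * real n * x" using x by (intro mult_left_mono) auto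
        thus ?thesis by (simp add: field_simps)
      qed
      ultimately have "exp (p * real (card (touching ?V S)) * (exp (\<sigma> * \<eta>) - 1 - \<sigma> * \<eta>)
          - \<eta> * (\<eta> * x * real n)) \<le> exp (- (\<eta>\<^sup>2 * real n * L / 4))"
        unfolding exp_le_cancel_iff by linarith
      thus "?P (B2 \<sigma> S) \<le> exp (- (\<eta>\<^sup>2 * real n * L / 4))"
        unfolding B2_def using gnp_chernoff[OF p touching_subset[OF order_refl]] order_trans by blast
    qed
    finally show ?thesis by (simp add: card_Pow)
  qed

  have P3: "?P (\<Union>U\<in>\<U>. \<Union>A\<in>Pow U. B3 U A) \<le> exp 2 * exp (- (L\<^sup>2 / 2))"
  proof -
    have single: "?P (B3 U A) \<le> exp (- (9 * x * L))" if U: "U \<in> \<U>" and A: "A \<in> Pow U" for U A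
    proof -
      have s0: "0 \<le> exp s - 1 - s" using exp_ge_add_one_self[of s] by linarith
      have "real (card (touching U A)) \<le> (real (card U))\<^sup>2 / 2"
        using A fin_sub[OF U] by (intro card_touching_le) auto
      also have "\<dots> \<le> (8 * x)\<^sup>2 / 2"
        using U by (intro divide_right_mono power_mono) (auto simp: \<U>_def)
      \<comment> \<open>The 32 in \<open>rate\<close> is (8 x)^2 / 2 divided by x^2.\<close>
      finally have "p * real (card (touching U A)) * (exp s - 1 - s) \<le> p * (32 * x\<^sup>2) * (exp s - 1 - s)"
        using p s0 by (intro mult_right_mono mult_left_mono) (auto simp: power_mult_distrib)
      hence "p * real (card (touching U A)) * (exp s - 1 - s) - s * (\<eta> * x\<^sup>2)
          \<le> - (x * (x * (s * \<eta> - 32 * p * (exp s - 1 - s))))"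
        by (simp add: algebra_simps power2_eq_square)
      also have "\<dots> \<le> - (x * (9 * L))"
        using mult_left_mono[OF rate x(2)] by (simp add: x_def L_def)
      finally have "exp (p * real (card (touching U A)) * (exp s - 1 - s) - s * (\<eta> * x\<^sup>2)) \<le> exp (- (9 * x * L))"
        by (simp add: mult_ac)
      moreover have "touching U A \<subseteq> all_edges ?V" using U by (intro touching_subset) (simp add: \<U>_def)
      ultimately show ?thesis
        unfolding B3_def using gnp_chernoff[OF p] order_trans by blast
    qed
    have "?P (\<Union>U\<in>\<U>. \<Union>A\<in>Pow U. B3 U A) \<le> (\<Sum>U\<in>\<U>. ?P (\<Union>A\<in>Pow U. B3 U A))"
      using fin\<U> by (intro measure_pmf.finite_measure_subadditive_finite) auto
    also have "\<dots> \<le> (\<Sum>U\<in>\<U>. \<Sum>A\<in>Pow U. ?P (B3 U A))"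
      using fin_sub by (intro sum_mono measure_pmf.finite_measure_subadditive_finite) auto
    also have "\<dots> \<le> (\<Sum>U\<in>\<U>. \<Sum>A\<in>Pow U. exp (- (9 * x * L)))"
      by (intro sum_mono single)
    also have "\<dots> = (\<Sum>U\<in>\<U>. 2 ^ card U * exp (- (9 * x * L)))"
      using fin_sub by (simp add: card_Pow)
    \<comment> \<open>The weights \<open>n powr (8 x - |U|) \<ge> 1\<close> replace a count of the small sets \<open>U\<close>.\<close>
    also have "\<dots> \<le> (\<Sum>U\<in>\<U>. (2 / real n) ^ card U * exp (- (x * L)))"
    proof (rule sum_mono)
      fix U assume U: "U \<in> \<U>"
      have "exp (- (9 * x * L)) \<le> exp (- (real (card U) * L)) * exp (- (x * L))"
      proof -
        have "real (card U) * L \<le> 8 * x * L" using U L by (intro mult_right_mono) (auto simp: \<U>_def)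
        thus ?thesis unfolding exp_add[symmetric] by (simp add: mult_ac)
      qed
      also have "exp (- (real (card U) * L)) = (1 / real n) ^ card U"
        using n by (simp add: exp_minus exp_of_nat_mult L_def power_one_over divide_inverse power_inverse)
      finally have "2 ^ card U * exp (- (9 * x * L)) \<le> 2 ^ card U * ((1 / real n) ^ card U * exp (- (x * L)))"
        by (rule mult_left_mono) simp
      also have "\<dots> = (2 / real n) ^ card U * exp (- (x * L))"
        by (simp add: power_divide)
      finally show "2 ^ card U * exp (- (9 * x * L)) \<le> (2 / real n) ^ card U * exp (- (x * L))" .
    qed
    also have "\<dots> \<le> (\<Sum>U\<in>Pow ?V. (2 / real n) ^ card U * exp (- (x * L)))"
      using fin\<U> by (intro sum_mono2) auto
    also have "\<dots> = (1 + 2 / real n) ^ n * exp (- (x * L))"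
      using sum_Pow_power_card[of ?V "2 / real n"] by (simp add: sum_distrib_right[symmetric])
    also have "\<dots> \<le> exp 2 * exp (- (L\<^sup>2 / 2))"
    proof (rule mult_mono)
      have "(1 + 2 / real n) ^ n \<le> exp (2 / real n) ^ n"
        by (intro power_mono exp_ge_add_one_self) auto
      thus "(1 + 2 / real n) ^ n \<le> exp 2" using n by (simp add: exp_of_nat_mult[symmetric])
      show "exp (- (x * L)) \<le> exp (- (L\<^sup>2 / 2))"
        using mult_right_mono[OF x(1), of L] L by (simp add: power2_eq_square)
    qed auto
    finally show ?thesis .
  qed

  have "?P {E. E \<subseteq> all_edges ?V \<and> \<not> pseudorandom ?V p \<eta> E}
      \<le> ?P ((\<Union>v<n. B1 v) \<union> (\<Union>\<sigma>\<in>{1, -1}. \<Union>S\<in>Pow ?V. B2 \<sigma> S) \<union> (\<Union>U\<in>\<U>. \<Union>A\<in>Pow U. B3 U A))"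
    by (rule measure_pmf.finite_measure_mono[OF cover]) simp
  also have "\<dots> \<le> ?P (\<Union>v<n. B1 v)
      + ?P (\<Union>\<sigma>\<in>{1, -1}. \<Union>S\<in>Pow ?V. B2 \<sigma> S) + ?P (\<Union>U\<in>\<U>. \<Union>A\<in>Pow U. B3 U A)"
    by (intro order_trans[OF measure_Un_le] add_right_mono) auto
  also have "?P (\<Union>\<sigma>\<in>{1, -1}. \<Union>S\<in>Pow ?V. B2 \<sigma> S)
      \<le> ?P (\<Union>S\<in>Pow ?V. B2 1 S) + ?P (\<Union>S\<in>Pow ?V. B2 (-1) S)"
    using measure_Un_le[of "\<Union>S\<in>Pow ?V. B2 1 S" "gnp n p" "\<Union>S\<in>Pow ?V. B2 (-1) S"] by simp
  finally show ?thesis using P1 P2[of 1] P2[of "-1"] P3 by (simp add: L_def)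
qed

subsection \<open>Sullivan vertices in the binomial random graph\<close>

text \<open>Restricting to the support of the measure allows the deterministic claims to assume that
  \<open>E\<close> consists of edges on the vertex set.\<close>

lemma prob_gnp_sullivan_ge:
  assumes "\<And>E. E \<subseteq> all_edges {..<n} \<Longrightarrow> E \<notin> B \<Longrightarrow>
      \<forall>D. is_orientation {..<n} E D \<longrightarrow> (\<exists>v. sullivan_vertex D v)"
  shows "1 - measure_pmf.prob (gnp n p) B \<le> measure_pmf.prob (gnp n p)
      {E. \<forall>D. is_orientation {..<n} E D \<longrightarrow> (\<exists>v. sullivan_vertex D v)}"
    (is "_ \<le> measure_pmf.prob _ ?G")
proof -
  have "1 - measure_pmf.prob (gnp n p) B = measure_pmf.prob (gnp n p) (- B)"
    using measure_pmf.prob_compl[of B "gnp n p"] by (simp add: Compl_eq_Diff_UNIV)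
  also have "\<dots> = measure_pmf.prob (gnp n p) (- B \<inter> set_pmf (gnp n p))"
    by (rule measure_Int_set_pmf[symmetric])
  also have "\<dots> \<le> measure_pmf.prob (gnp n p) ?G"
  proof (rule measure_pmf.finite_measure_mono)
    show "- B \<inter> set_pmf (gnp n p) \<subseteq> ?G"
      using assms set_pmf_gnp[of n p] by blast
  qed simp
  finally show ?thesis .
qed

lemma isolated_imp_sullivan:
  assumes orient: "is_orientation V E D" and E: "E \<subseteq> all_edges V"
    and v: "v \<in> V" "E \<inter> touching V {v} = {}"
  shows "sullivan_vertex D v"
proof -
  have "in_nbhd D v = {}"
  proof (rule ccontr)
    assume "in_nbhd D v \<noteq> {}"
    then obtain w where "(w, v) \<in> parcs D" by (auto simp: in_nbhd_def)
    hence "{w, v} \<in> E" using orient by (simp add: is_orientation_def)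
    hence "{w, v} \<in> E \<inter> touching V {v}" using E by (auto simp: touching_def)
    thus False using v by simp
  qed
  moreover have "v \<in> pverts D" using orient v by (simp add: is_orientation_def)
  ultimately show ?thesis by (simp add: sullivan_vertex_def)
qed

text \<open>At this threshold the power is asymptotic to n^(-1/2), so the expected number of
  isolated vertices grows like the square root of n.\<close>

lemma isolated_error_tendsto_0:
  "(\<lambda>n. 1 / (real n * (1 - ln (real n) / (2 * real n)) ^ n)
      + 1 / (1 - ln (real n) / (2 * real n)) - 1) \<longlonglongrightarrow> 0"
  by real_asymp

lemma pseudorandom_error_tendsto_0:
  fixes c :: real
  assumes "0 < c"
  shows "(\<lambda>n. real n * exp (- 3 * ln (real n)) + 2 * 2 ^ n * exp (- (c * real n * ln (real n) / 4))
      + exp 2 * exp (- ((ln (real n))\<^sup>2 / 2))) \<longlonglongrightarrow> 0"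
  using assms by real_asymp

theorem theoremA2:
  fixes p :: "nat \<Rightarrow> real"
  assumes "\<And>n. p n \<in> {0..1}"
    and "limsup (\<lambda>n. ereal (p n)) < ereal (1 / 2)"
  shows "(\<lambda>n. measure_pmf.prob (gnp n (p n))
            {E. \<forall>D. is_orientation {..<n} E D \<longrightarrow> (\<exists>v. sullivan_vertex D v)})
         \<longlonglongrightarrow> 1"
proof -
  define P where "P n = measure_pmf.prob (gnp n (p n))
      {E. \<forall>D. is_orientation {..<n} E D \<longrightarrow> (\<exists>v. sullivan_vertex D v)}" for n
  obtain r where r: "limsup (\<lambda>n. ereal (p n)) < ereal r" "r < 1 / 2"
    using ereal_dense2[OF assms(2)] by auto
  define \<gamma> where "\<gamma> = 1 / 2 - r"
  define \<eta> where "\<eta> = min (\<gamma> / 200) 1"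
  have \<eta>: "0 < \<eta>" "\<eta> \<le> 1" "200 * \<eta> \<le> \<gamma>" using r(2) by (auto simp: \<eta>_def \<gamma>_def min_def)
  \<comment> \<open>Here s \<eta> = 36, and \<open>p\<^sub>0\<close> is chosen so that 32 p exp(s)
    <= 18 for p up to \<open>p\<^sub>0\<close>. The difference 18 is 2 times 9, which suffices when
    n p >= ln n / 2.\<close>
  define s where "s = 36 / \<eta>"
  define p\<^sub>0 where "p\<^sub>0 = 18 / (32 * exp s)"
  define c where "c = p\<^sub>0 * (\<eta>\<^sup>2 / 128)"
  have pos: "0 < s" "0 < p\<^sub>0" "0 < c" using \<eta> by (auto simp: s_def p\<^sub>0_def c_def)
  define e\<^sub>1 where "e\<^sub>1 n = 1 / (real n * (1 - ln (real n) / (2 * real n)) ^ n)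
      + 1 / (1 - ln (real n) / (2 * real n)) - 1" for n :: nat
  define e\<^sub>2 where "e\<^sub>2 n = real n * exp (- 3 * ln (real n))
      + 2 * 2 ^ n * exp (- (\<eta>\<^sup>2 * real n * ln (real n) / 4))
      + exp 2 * exp (- ((ln (real n))\<^sup>2 / 2))" for n :: nat
  have "\<eta>\<^sup>2 > 0" using \<eta> by simp
  have lim: "e\<^sub>1 \<longlonglongrightarrow> 0" "e\<^sub>2 \<longlonglongrightarrow> 0"
    using isolated_error_tendsto_0 pseudorandom_error_tendsto_0[OF \<open>\<eta>\<^sup>2 > 0\<close>]
    unfolding e\<^sub>1_def e\<^sub>2_def by blast+

  have ev: "eventually (\<lambda>n. p n < r) sequentially"
    using Limsup_lessD[OF r(1)] by simp
  have "eventually (\<lambda>n. 9 * ln (real n) \<le> c * real n) sequentially"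
    using pos(3) by real_asymp
  moreover have "eventually (\<lambda>n. ln (real n) < 2 * real n) sequentially"
    by real_asymp
  moreover have "eventually (\<lambda>n. 1 \<le> \<eta> * real n) sequentially"
    using \<eta>(1) by real_asymp
  \<comment> \<open>The regime may change with n infinitely often, so the bound takes the larger of
    the two errors.\<close>
  ultimately
  have "eventually (\<lambda>n. 1 - max (e\<^sub>1 n) (e\<^sub>2 n) \<le> P n) sequentially"
    using ev eventually_ge_at_top[of 2]
  proof eventually_elim
    case (elim n)
    have n0: "0 < real n" using elim by simp
    have p01: "p n \<in> {0..1}" by (rule assms)
    show ?case
    proof (cases "p n * real n < ln (real n) / 2")
      case True
      define l where "l = ln (real n) / (2 * real n)"
      have l: "p n \<le> l" "l < 1" using True n0 elim by (auto simp: l_def field_simps)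
      have "1 - measure_pmf.prob (gnp n (p n)) {E. \<forall>v<n. E \<inter> touching {..<n} {v} \<noteq> {}} \<le> P n"
        unfolding P_def
      proof (rule prob_gnp_sullivan_ge, intro allI impI)
        fix E D
        assume E: "E \<subseteq> all_edges {..<n}" "E \<notin> {E. \<forall>v<n. E \<inter> touching {..<n} {v} \<noteq> {}}"
          and orient: "is_orientation {..<n} E D"
        then obtain v where "v \<in> {..<n}" "E \<inter> touching {..<n} {v} = {}" by auto
        from isolated_imp_sullivan[OF orient E(1) this] show "\<exists>v. sullivan_vertex D v" ..
      qed
      moreover have "measure_pmf.prob (gnp n (p n)) {E. \<forall>v<n. E \<inter> touching {..<n} {v} \<noteq> {}}
          \<le> 1 / (real n * (1 - p n) ^ (n - 1)) + 1 / (1 - p n) - 1"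
        using p01 l elim by (intro prob_gnp_no_isolated_le) auto
      \<comment> \<open>The error bound increases with the edge probability, so \<open>p n\<close>
        may be replaced by the threshold \<open>l\<close>.\<close>
      moreover have "\<dots> \<le> 1 / (real n * (1 - l) ^ n) + 1 / (1 - l) - 1"
      proof -
        have "(1 - l) ^ n \<le> (1 - p n) ^ n" using l by (intro power_mono) auto
        also have "\<dots> \<le> (1 - p n) ^ (n - 1)" using p01 by (intro power_decreasing) auto
        finally have "1 / (real n * (1 - p n) ^ (n - 1)) \<le> 1 / (real n * (1 - l) ^ n)"
          using n0 l by (intro divide_left_mono mult_left_mono mult_pos_pos) auto
        moreover have "1 / (1 - p n) \<le> 1 / (1 - l)"
          using l by (intro divide_left_mono mult_pos_pos) auto
        ultimately show ?thesis by linarith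
      qed
      ultimately have "1 - e\<^sub>1 n \<le> P n" unfolding e\<^sub>1_def l_def by linarith
      thus ?thesis by linarith
    next
      case False
      hence pn: "ln (real n) / 2 \<le> p n * real n" by simp
      have "0 < ln (real n)" using elim by simp
      hence p_pos: "0 < p n" using pn p01 n0 by (cases "p n = 0") auto
      \<comment> \<open>For small \<open>p\<close> the Chernoff parameter must be large, since \<open>n p\<close> may be as small as
        \<open>ln n / 2\<close>; for \<open>p\<close> bounded away from \<open>0\<close> a small one suffices.\<close>
      have "\<exists>t\<ge>0. 9 * ln (real n) \<le> p n * real n * (t * \<eta> - 32 * p n * (exp t - 1 - t))"
      proof (cases "p n \<le> p\<^sub>0")
        case True
        have "0 \<le> exp s - 1 - s" using exp_ge_add_one_self[of s] by linarith
        hence "32 * p n * (exp s - 1 - s) \<le> 32 * p\<^sub>0 * exp s"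
          using True p_pos pos by (intro mult_mono) auto
        also have "\<dots> = 18" by (simp add: p\<^sub>0_def)
        finally have "18 \<le> s * \<eta> - 32 * p n * (exp s - 1 - s)" using \<eta> by (simp add: s_def)
        hence "p n * real n * 18 \<le> p n * real n * (s * \<eta> - 32 * p n * (exp s - 1 - s))"
          using p_pos n0 by (intro mult_left_mono) auto
        thus ?thesis using pn pos by (intro exI[of _ s]) auto
      next
        case False
        \<comment> \<open>This maximizes t \<eta> - 32 t^2, with maximum \<eta>^2 / 128, the
          constant occurring in \<open>c\<close>.\<close>
        define t where "t = \<eta> / 64"
        have t: "0 \<le> t" "\<bar>t\<bar> \<le> 1" using \<eta> by (auto simp: t_def)
        have "0 \<le> exp t - 1 - t" using exp_ge_add_one_self[of t] by linarith
        hence "32 * p n * (exp t - 1 - t) \<le> 32 * 1 * t\<^sup>2"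
          using p01 exp_minus_linear_le_square[OF t(2)]
          by (intro mult_mono) auto
        hence "\<eta>\<^sup>2 / 128 \<le> t * \<eta> - 32 * p n * (exp t - 1 - t)"
          by (simp add: t_def power2_eq_square)
        hence "p\<^sub>0 * real n * (\<eta>\<^sup>2 / 128)
            \<le> p n * real n * (t * \<eta> - 32 * p n * (exp t - 1 - t))"
          using False p_pos by (intro mult_mono mult_right_mono) auto
        moreover have "c * real n = p\<^sub>0 * real n * (\<eta>\<^sup>2 / 128)" by (simp add: c_def)
        ultimately have "9 * ln (real n) \<le> p n * real n * (t * \<eta> - 32 * p n * (exp t - 1 - t))"
          using elim by linarith
        thus ?thesis using t by blast
      qed
      then obtain t where t: "0 \<le> t"
        "9 * ln (real n) \<le> p n * real n * (t * \<eta> - 32 * p n * (exp t - 1 - t))" by blast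
      have "1 - measure_pmf.prob (gnp n (p n))
          {E. E \<subseteq> all_edges {..<n} \<and> \<not> pseudorandom {..<n} (p n) \<eta> E} \<le> P n"
        unfolding P_def
      proof (rule prob_gnp_sullivan_ge, intro allI impI)
        fix E D
        assume "E \<subseteq> all_edges {..<n}" "is_orientation {..<n} E D"
          "E \<notin> {E. E \<subseteq> all_edges {..<n} \<and> \<not> pseudorandom {..<n} (p n) \<eta> E}"
        thus "\<exists>v. sullivan_vertex D v"
          using p_pos elim \<eta> by (intro pseudorandom_imp_sullivan[of "{..<n}" E D "p n" \<gamma> \<eta>]) (auto simp: \<gamma>_def)
      qed
      moreover have "measure_pmf.prob (gnp n (p n))
          {E. E \<subseteq> all_edges {..<n} \<and> \<not> pseudorandom {..<n} (p n) \<eta> E} \<le> e\<^sub>2 n"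
        unfolding e\<^sub>2_def by (rule prob_gnp_not_pseudorandom_le[OF p01 _ pn \<eta>(1,2) t]) (use elim in simp)
      ultimately show ?thesis by linarith
    qed
  qed
  moreover have "eventually (\<lambda>n. P n \<le> 1) sequentially" by (simp add: P_def)
  moreover have "(\<lambda>n. 1 - max (e\<^sub>1 n) (e\<^sub>2 n)) \<longlonglongrightarrow> 1"
    using tendsto_diff[OF tendsto_const tendsto_max[OF lim], of 1] by simp
  ultimately have "P \<longlonglongrightarrow> 1"
    by (intro tendsto_sandwich[OF _ _ _ tendsto_const, of _ P sequentially 1]) auto
  thus ?thesis unfolding P_def .
qed

end
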